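(* Let $n$, $d$ and $k$ be positive integers such that $d\ge 3$ (and $d+1\le n/2$). If $C$ is an identifying code in $C_n(1,d-1,d,d+1)$ with $k$ codewords, then there exists an identifying code in the infinite king grid $\mathcal{K}$ with density $k/n$. Analogously, a locating-dominating (respectively self-identifying) code in $C_n(1,d-1,d,d+1)$ with $k$ codewords yields a locating-dominating (respectively self-identifying) code in $\mathcal{K}$ with density $k/n$.
   Context: All graphs are simple and undirected. For a graph $G=(V,E)$ and $u\in V$, $N[u]=\{u\}\cup\{v: uv\in E\}$. A code is a nonempty $C\subseteq V$, and $I(C;u)=N[u]\cap C$. $C$ is dominating if $I(C;u)\neq\emptyset$ for all $u$; identifying if dominating and $I(C;u)\neq I(C;v)$ for all distinct $u,v\in V$; locating-dominating if dominating and $I(C;u)\neq I(C;v)$ for all distinct $u,v\in V\setminus C$; self-identifying if $I(C;u)\setminus I(C;v)\neq\emptyset$ for all distinct $u,v\in V$. For positive integers $n$ and $d_1,\dots,d_k\le n/2$, the circulant graph $C_n(d_1,\dots,d_k)$ has vertex set $\mathbb{Z}_n$, and the open neighbourhood of $u$ is $\{u\pm d_1,\dots,u\pm d_k\}$ modulo $n$. The infinite king grid $\mathcal{K}$ has vertex set $\mathbb{Z}^2$ and $N[(x,y)]=\{(x',y')\in\mathbb{Z}^2: |x-x'|\le1,|y-y'|\le1\}$. With $Q_m=\{(x,y)\in\mathbb{Z}^2:|x|\le m,|y|\le m\}$, the density of $C\subseteq\mathbb{Z}^2$ is $\limsup_{m\to\infty}|C\cap Q_m|/|Q_m|$. *)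

theory Defs
  imports Complex_Main "HOL-Library.Extended_Real"
begin

type_synonym 'a graph = "'a set \<times> 'a set set"

abbreviation verts :: "'a graph \<Rightarrow> 'a set" where "verts G \<equiv> fst G"
abbreviation edges :: "'a graph \<Rightarrow> 'a set set" where "edges G \<equiv> snd G"

definition simple_graph :: "'a graph \<Rightarrow> bool" where
  "simple_graph G \<longleftrightarrow> (\<forall>e \<in> edges G. \<exists>u \<in> verts G. \<exists>v \<in> verts G. u \<noteq> v \<and> e = {u, v})"

definition closed_nbhd :: "'a graph \<Rightarrow> 'a \<Rightarrow> 'a set" where
  "closed_nbhd G u = {u} \<union> {v. {u, v} \<in> edges G}"

definition is_code :: "'a graph \<Rightarrow> 'a set \<Rightarrow> bool" where
  "is_code G C \<longleftrightarrow> C \<noteq> {} \<and> C \<subseteq> verts G"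

definition Iset :: "'a graph \<Rightarrow> 'a set \<Rightarrow> 'a \<Rightarrow> 'a set" where
  "Iset G C u = closed_nbhd G u \<inter> C"

definition dominating_code :: "'a graph \<Rightarrow> 'a set \<Rightarrow> bool" where
  "dominating_code G C \<longleftrightarrow> is_code G C \<and> (\<forall>u \<in> verts G. Iset G C u \<noteq> {})"

definition identifying_code :: "'a graph \<Rightarrow> 'a set \<Rightarrow> bool" where
  "identifying_code G C \<longleftrightarrow> dominating_code G C \<and>
     (\<forall>u \<in> verts G. \<forall>v \<in> verts G. u \<noteq> v \<longrightarrow> Iset G C u \<noteq> Iset G C v)"

definition locating_dominating_code :: "'a graph \<Rightarrow> 'a set \<Rightarrow> bool" where
  "locating_dominating_code G C \<longleftrightarrow> dominating_code G C \<and>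
     (\<forall>u \<in> verts G - C. \<forall>v \<in> verts G - C. u \<noteq> v \<longrightarrow> Iset G C u \<noteq> Iset G C v)"

definition self_identifying_code :: "'a graph \<Rightarrow> 'a set \<Rightarrow> bool" where
  "self_identifying_code G C \<longleftrightarrow> is_code G C \<and>
     (\<forall>u \<in> verts G. \<forall>v \<in> verts G. u \<noteq> v \<longrightarrow> Iset G C u - Iset G C v \<noteq> {})"

text \<open>The vertex set \<open>\<int>\<^sub>n\<close> is represented by the residues \<open>0, \<dots>, n - 1\<close>. The intended
  parameters are \<open>n > 0\<close> and \<open>D \<subseteq> {1..n div 2}\<close>.\<close>

definition circulant_graph :: "nat \<Rightarrow> nat set \<Rightarrow> int graph" where
  "circulant_graph n D =
     ({0..<int n},
      {{u, v} | u v. u \<in> {0..<int n} \<and>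
         (\<exists>d \<in> D. v = (u + int d) mod int n \<or> v = (u - int d) mod int n)})"

lemma circulant_shift_neq:
  fixes u :: int
  assumes "0 < d" "2 * d \<le> n"
  shows "(u + int d) mod int n \<noteq> u" "(u - int d) mod int n \<noteq> u"
proof -
  have nd: "\<not> int n dvd int d"
    using assms by (auto dest!: zdvd_imp_le)
  show "(u + int d) mod int n \<noteq> u"
  proof
    assume "(u + int d) mod int n = u"
    then have "int n dvd (u + int d) - u"
      by (metis mod_eq_dvd_iff mod_mod_trivial)
    with nd show False by simp
  qed
  show "(u - int d) mod int n \<noteq> u"
  proof
    assume "(u - int d) mod int n = u"
    then have "int n dvd u - (u - int d)"
      by (metis mod_eq_dvd_iff mod_mod_trivial)
    with nd show False by simp
  qed
qed

lemma simple_graph_circulant: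
  assumes "0 < n" "\<forall>d \<in> D. 0 < d \<and> 2 * d \<le> n"
  shows "simple_graph (circulant_graph n D)"
  unfolding simple_graph_def
proof
  fix e assume "e \<in> edges (circulant_graph n D)"
  then obtain u v d where e: "e = {u, v}" "u \<in> {0..<int n}" "d \<in> D"
      "v = (u + int d) mod int n \<or> v = (u - int d) mod int n"
    by (auto simp: circulant_graph_def)
  have "u \<noteq> v"
    using e assms circulant_shift_neq[of d n u] by metis
  moreover have "v \<in> {0..<int n}"
    using e(4) assms(1) by auto
  ultimately show "\<exists>u \<in> verts (circulant_graph n D). \<exists>v \<in> verts (circulant_graph n D).
      u \<noteq> v \<and> e = {u, v}"
    using e(1,2) unfolding circulant_graph_def fst_conv by blast
qed

lemma closed_nbhd_circulant:
  assumes "u \<in> {0..<int n}"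
  shows "closed_nbhd (circulant_graph n D) u =
    {u} \<union> (\<Union>d \<in> D. {(u + int d) mod int n, (u - int d) mod int n})"
    (is "?L = ?R")
proof
  show "?R \<subseteq> ?L"
    using assms by (auto simp: closed_nbhd_def circulant_graph_def)
  show "?L \<subseteq> ?R"
  proof
    fix v assume "v \<in> ?L"
    then consider "v = u" | "{u, v} \<in> edges (circulant_graph n D)"
      by (auto simp: closed_nbhd_def)
    then show "v \<in> ?R"
    proof cases
      case 2
      then obtain a b d where ab: "{u, v} = {a, b}" "a \<in> {0..<int n}" "d \<in> D"
        "b = (a + int d) mod int n \<or> b = (a - int d) mod int n"
        by (auto simp: circulant_graph_def)
      from ab(1) consider "u = a" "v = b" | "u = b" "v = a"
        by (auto simp: doubleton_eq_iff)
      then show ?thesis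
      proof cases
        case 1
        with ab show ?thesis by auto
      next
        case 2
        have "a = (b - int d) mod int n \<or> a = (b + int d) mod int n"
          using ab(2,4) by (auto simp: mod_simps)
        with 2 ab(3) show ?thesis by auto
      qed
    qed simp
  qed
qed

definition king_grid :: "(int \<times> int) graph" where
  "king_grid =
     (UNIV,
      {{(x, y), (x', y')} | x y x' y'.
         (x, y) \<noteq> (x', y') \<and> \<bar>x - x'\<bar> \<le> 1 \<and> \<bar>y - y'\<bar> \<le> 1})"

lemma simple_graph_king_grid: "simple_graph king_grid"
  unfolding simple_graph_def king_grid_def by auto

lemma closed_nbhd_king_grid:
  "closed_nbhd king_grid (x, y) = {(x', y'). \<bar>x - x'\<bar> \<le> 1 \<and> \<bar>y - y'\<bar> \<le> 1}"
  by (auto simp: closed_nbhd_def king_grid_def doubleton_eq_iff)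

definition Qbox :: "nat \<Rightarrow> (int \<times> int) set" where
  "Qbox m = {(x, y). \<bar>x\<bar> \<le> int m \<and> \<bar>y\<bar> \<le> int m}"

definition grid_density :: "(int \<times> int) set \<Rightarrow> ereal" where
  "grid_density C = limsup (\<lambda>m. ereal (real (card (C \<inter> Qbox m)) / real (card (Qbox m))))"

end

theory Submission imports Defs begin

text \<open>The map \<open>(x, y) \<mapsto> x + d y\<close> sends closed neighbourhoods of the king grid onto closed
  neighbourhoods of the circulant graph, so the preimage of a code separates grid vertices with
  distinct images. Two distinct vertices \<open>u\<close>, \<open>u + t\<close> with the same image are separated too: their
  I-sets are nonempty, finite and translates of each other by \<open>t\<close>, and no nonempty finite set of
  grid points is invariant under a nonzero translation. The density is the one of a periodic set
  meeting each horizontal period of length \<open>n\<close> in \<open>k\<close> points.\<close>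

section \<open>Projection of the king grid onto the circulant graph\<close>

definition grid_proj :: "nat \<Rightarrow> nat \<Rightarrow> int \<times> int \<Rightarrow> int" where
  "grid_proj n d p = (fst p + int d * snd p) mod int n"

definition code_lift :: "nat \<Rightarrow> nat \<Rightarrow> int set \<Rightarrow> (int \<times> int) set" where
  "code_lift n d C = {p. grid_proj n d p \<in> C}"

lemma grid_proj_in_verts: "n > 0 \<Longrightarrow> grid_proj n d p \<in> {0..<int n}"
  by (simp add: grid_proj_def)

lemma verts_circulant_graph [simp]: "verts (circulant_graph n D) = {0..<int n}"
  by (simp add: circulant_graph_def)

lemma verts_king_grid [simp]: "verts king_grid = UNIV"
  by (simp add: king_grid_def)

text \<open>Writing the neighbourhood as an image of the nine offsets makes its finiteness immediate
  and lets the projection be applied by composing images.\<close>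

lemma closed_nbhd_king_grid_image:
  "closed_nbhd king_grid (x, y) = (\<lambda>(i, j). (x + i, y + j)) ` ({-1, 0, 1} \<times> {-1, 0, 1})"
proof (intro equalityI subsetI)
  fix p
  assume p: "p \<in> closed_nbhd king_grid (x, y)"
  \<comment> \<open>Used with \<open>t\<close> the displacement from the centre to \<open>p\<close>;
    the sign in \<open>- t\<close> matches the order of subtraction in the king grid
    neighbourhood.\<close>
  have *: "t = -1 \<or> t = 0 \<or> t = 1" if "\<bar>- t\<bar> \<le> 1" for t :: int
    using that by presburger
  have "fst p - x \<in> {-1, 0, 1}" "snd p - y \<in> {-1, 0, 1}"
    using p *[of "fst p - x"] *[of "snd p - y"] by (auto simp: closed_nbhd_king_grid)
  then show "p \<in> (\<lambda>(i, j). (x + i, y + j)) ` ({-1, 0, 1} \<times> {-1, 0, 1})"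
    by (intro image_eqI[of _ _ "(fst p - x, snd p - y)"] SigmaI) simp_all
next
  fix p
  assume "p \<in> (\<lambda>(i, j). (x + i, y + j)) ` ({-1, 0, 1} \<times> {-1, 0, 1})"
  then show "p \<in> closed_nbhd king_grid (x, y)"
    unfolding closed_nbhd_king_grid by auto
qed

text \<open>A grid offset \<open>(i, j)\<close> shifts the projection by \<open>i + d * j\<close>.
  For \<open>i\<close>, \<open>j\<close> in \<open>{-1, 0, 1}\<close> these shifts are 0 and plus or
  minus 1, \<open>d - 1\<close>, \<open>d\<close>, \<open>d + 1\<close>, the differences that define
  the circulant neighbourhood.\<close>

lemma grid_proj_image_closed_nbhd:
  assumes "n > 0" "d > 0"
  shows "grid_proj n d ` closed_nbhd king_grid p =
    closed_nbhd (circulant_graph n {1, d - 1, d, d + 1}) (grid_proj n d p)"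
proof -
  obtain x y where p: "p = (x, y)" by fastforce
  define s where "s = x + int d * y"
  have "grid_proj n d ` closed_nbhd king_grid p =
      (\<lambda>(i, j). (s + (i + int d * j)) mod int n) ` ({-1, 0, 1} \<times> {-1, 0, 1})"
    unfolding p closed_nbhd_king_grid_image image_image
    by (rule image_cong) (auto simp: grid_proj_def s_def algebra_simps)
  also have "\<dots> = {s mod int n} \<union>
      (\<Union>e \<in> {1, d - 1, d, d + 1}. {(s + int e) mod int n, (s - int e) mod int n})"
    \<comment> \<open>Since \<open>d > 0\<close>, the natural number \<open>d - 1\<close> is not
      truncated and agrees with the integer difference.\<close>
    using assms(2) by (auto simp: algebra_simps)
  also have "\<dots> = closed_nbhd (circulant_graph n {1, d - 1, d, d + 1}) (s mod int n)"
    using assms(1) by (subst closed_nbhd_circulant) (auto simp: mod_simps)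
  also have "s mod int n = grid_proj n d p"
    by (simp add: p s_def grid_proj_def)
  finally show ?thesis .
qed

text \<open>The lift is a full preimage, and f(A \<inter> f^{-1}(C)) = f(A) \<inter> C. Hence
  equalities and inclusions between I-sets in the grid pass to the circulant graph.\<close>

lemma grid_proj_image_Iset:
  assumes "n > 0" "d > 0"
  shows "grid_proj n d ` Iset king_grid (code_lift n d C) p =
    Iset (circulant_graph n {1, d - 1, d, d + 1}) C (grid_proj n d p)"
  unfolding Iset_def grid_proj_image_closed_nbhd[OF assms, symmetric]
  by (auto simp: code_lift_def)

section \<open>Grid vertices with the same projection\<close>

lemma finite_Iset_king_grid: "finite (Iset king_grid C p)"
  by (cases p) (simp add: Iset_def closed_nbhd_king_grid_image)

text \<open>By cardinality, the inclusion is an equality. Translation adds \<open>card A * a\<close>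
  and \<open>card A * b\<close> to the two coordinate sums, so equal sums and
  \<open>card A > 0\<close> force both shifts to vanish.\<close>

lemma finite_translate_subset_imp_zero:
  fixes A :: "(int \<times> int) set"
  assumes "finite A" "A \<noteq> {}" and sub: "A \<subseteq> (\<lambda>(x, y). (x + a, y + b)) ` A"
  shows "a = 0 \<and> b = 0"
proof -
  let ?T = "\<lambda>(x, y). (x + a, y + b)"
  have inj: "inj_on ?T A"
    by (auto simp: inj_on_def)
  have eq: "A = ?T ` A"
    using assms(1) sub inj by (intro card_subset_eq) (auto simp: card_image)
  have card: "int (card A) > 0"
    using assms(1,2) by (simp add: card_gt_0_iff)
  have "sum fst A = sum (fst \<circ> ?T) A" "sum snd A = sum (snd \<circ> ?T) A"
    using eq inj by (metis sum.reindex)+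
  then have "sum fst A = sum fst A + int (card A) * a"
    "sum snd A = sum snd A + int (card A) * b"
    by (simp_all add: case_prod_unfold o_def sum.distrib)
  then show ?thesis using card by simp
qed

text \<open>Equal projections mean that \<open>n\<close> divides \<open>a + d * b\<close>, so
  \<open>(a, b)\<close> is a period of the projection and of the lift. King neighbourhoods are
  translation invariant.\<close>

lemma Iset_code_lift_translate:
  assumes "grid_proj n d (x, y) = grid_proj n d (x + a, y + b)"
  shows "Iset king_grid (code_lift n d C) (x + a, y + b) =
    (\<lambda>(x, y). (x + a, y + b)) ` Iset king_grid (code_lift n d C) (x, y)"
proof -
  have ab: "(a + int d * b) mod int n = 0"
  proof -
    have "((x + a + int d * (y + b)) - (x + int d * y)) mod int n = 0"
      using assms unfolding grid_proj_def fst_conv snd_conv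
      by (metis mod_eq_dvd_iff mod_0_imp_dvd dvd_imp_mod_0)
    then show ?thesis by (simp add: algebra_simps)
  qed
  have "grid_proj n d (x' + a, y' + b) = grid_proj n d (x', y')" for x' y'
  proof -
    have "(x' + a + int d * (y' + b)) = (x' + int d * y') + (a + int d * b)"
      by (simp add: algebra_simps)
    then show ?thesis
      using ab unfolding grid_proj_def fst_conv snd_conv by (metis mod_add_right_eq add_0_right)
  qed
  then have lift: "(x' + a, y' + b) \<in> code_lift n d C \<longleftrightarrow> (x', y') \<in> code_lift n d C" for x' y'
    by (simp add: code_lift_def)
  show ?thesis
  proof (intro equalityI subsetI)
    fix p
    assume p: "p \<in> Iset king_grid (code_lift n d C) (x + a, y + b)"
    show "p \<in> (\<lambda>(x, y). (x + a, y + b)) ` Iset king_grid (code_lift n d C) (x, y)"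
    proof (rule image_eqI)
      show "p = (\<lambda>(x, y). (x + a, y + b)) (fst p - a, snd p - b)"
        by simp
      show "(fst p - a, snd p - b) \<in> Iset king_grid (code_lift n d C) (x, y)"
        using p lift[of "fst p - a" "snd p - b"]
        by (auto simp: Iset_def closed_nbhd_king_grid)
    qed
  next
    fix p
    assume "p \<in> (\<lambda>(x, y). (x + a, y + b)) ` Iset king_grid (code_lift n d C) (x, y)"
    then show "p \<in> Iset king_grid (code_lift n d C) (x + a, y + b)"
      by (auto simp: Iset_def closed_nbhd_king_grid lift)
  qed
qed

text \<open>An inclusion would place a nonempty finite I-set inside its own translate by
  \<open>v - u\<close>, forcing \<open>u = v\<close>. Non-inclusion is the form required for
  self-identification, and it also gives inequality.\<close>

lemma Iset_code_lift_not_subset: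
  assumes "u \<noteq> v" "grid_proj n d u = grid_proj n d v"
    and "Iset king_grid (code_lift n d C) u \<noteq> {}"
  shows "\<not> Iset king_grid (code_lift n d C) u \<subseteq> Iset king_grid (code_lift n d C) v"
proof
  assume sub: "Iset king_grid (code_lift n d C) u \<subseteq> Iset king_grid (code_lift n d C) v"
  obtain x y where u: "u = (x, y)" by fastforce
  obtain a b where v: "v = (x + a, y + b)"
    by (metis surj_pair add_diff_cancel_left' add.commute diff_add_cancel)
  have "a = 0 \<and> b = 0"
    using finite_translate_subset_imp_zero[OF finite_Iset_king_grid assms(3)] sub
      Iset_code_lift_translate assms(2) unfolding u v by simp
  then show False using assms(1) u v by simp
qed

section \<open>Transfer of the code properties\<close>

lemma is_code_code_lift:
  assumes "is_code (circulant_graph n D) C"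
  shows "is_code king_grid (code_lift n d C)"
proof -
  obtain c where c: "c \<in> C" "0 \<le> c" "c < int n"
    using assms by (fastforce simp: is_code_def)
  \<comment> \<open>On the row \<open>y = 0\<close> the projection is plain reduction modulo
    \<open>n\<close>, which fixes the representative \<open>c\<close>.\<close>
  then have "(c, 0) \<in> code_lift n d C"
    by (simp add: code_lift_def grid_proj_def)
  then show ?thesis by (auto simp: is_code_def)
qed

lemma dominating_code_code_lift:
  assumes "n > 0" "d > 0" "dominating_code (circulant_graph n {1, d - 1, d, d + 1}) C"
  shows "dominating_code king_grid (code_lift n d C)"
  unfolding dominating_code_def
proof (intro conjI ballI)
  show "is_code king_grid (code_lift n d C)"
    using assms(3) is_code_code_lift dominating_code_def by metis
  show "Iset king_grid (code_lift n d C) u \<noteq> {}" for u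
    using grid_proj_image_Iset[OF assms(1,2), of C u] assms(3) grid_proj_in_verts[OF assms(1), of d u]
    unfolding dominating_code_def verts_circulant_graph by (metis image_empty)
qed

lemma identifying_code_code_lift:
  assumes "n > 0" "d > 0" "identifying_code (circulant_graph n {1, d - 1, d, d + 1}) C"
  shows "identifying_code king_grid (code_lift n d C)"
  unfolding identifying_code_def
proof (intro conjI ballI impI)
  show dom: "dominating_code king_grid (code_lift n d C)"
    using assms dominating_code_code_lift by (simp add: identifying_code_def)
  fix u v :: "int \<times> int"
  assume "u \<noteq> v"
  show "Iset king_grid (code_lift n d C) u \<noteq> Iset king_grid (code_lift n d C) v"
  proof (cases "grid_proj n d u = grid_proj n d v")
    case True
    then show ?thesis
      using Iset_code_lift_not_subset[OF \<open>u \<noteq> v\<close> True, of C] dom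
      unfolding dominating_code_def verts_king_grid by blast
  next
    case False
    \<comment> \<open>Equal I-sets of \<open>u\<close> and \<open>v\<close> would have equal
      projections, contradicting that \<open>C\<close> separates the two distinct residues.\<close>
    then show ?thesis
      using assms(3) grid_proj_in_verts[OF assms(1)] grid_proj_image_Iset[OF assms(1,2)]
      unfolding identifying_code_def verts_circulant_graph by metis
  qed
qed

lemma locating_dominating_code_code_lift:
  assumes "n > 0" "d > 0" "locating_dominating_code (circulant_graph n {1, d - 1, d, d + 1}) C"
  shows "locating_dominating_code king_grid (code_lift n d C)"
  unfolding locating_dominating_code_def
proof (intro conjI ballI impI)
  show dom: "dominating_code king_grid (code_lift n d C)"
    using assms dominating_code_code_lift by (simp add: locating_dominating_code_def)
  fix u v :: "int \<times> int"
  assume uv: "u \<in> verts king_grid - code_lift n d C" "v \<in> verts king_grid - code_lift n d C" "u \<noteq> v"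
  show "Iset king_grid (code_lift n d C) u \<noteq> Iset king_grid (code_lift n d C) v"
  proof (cases "grid_proj n d u = grid_proj n d v")
    case True
    then show ?thesis
      using Iset_code_lift_not_subset[OF \<open>u \<noteq> v\<close> True, of C] dom
      unfolding dominating_code_def verts_king_grid by blast
  next
    case False
    \<comment> \<open>Vertices outside the lift project outside \<open>C\<close>, so the separation
      property of \<open>C\<close> for non-codewords applies.\<close>
    have "grid_proj n d u \<in> {0..<int n} - C" "grid_proj n d v \<in> {0..<int n} - C"
      using uv grid_proj_in_verts[OF assms(1)] by (auto simp: code_lift_def)
    with False show ?thesis
      using assms(3) grid_proj_image_Iset[OF assms(1,2)]
      unfolding locating_dominating_code_def verts_circulant_graph by metis
  qed
qed

lemma self_identifying_code_code_lift:
  assumes "n > 1" "d > 0" "self_identifying_code (circulant_graph n {1, d - 1, d, d + 1}) C"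
  shows "self_identifying_code king_grid (code_lift n d C)"
  unfolding self_identifying_code_def
proof (intro conjI ballI impI)
  let ?G = "circulant_graph n {1, d - 1, d, d + 1}"
  have n: "n > 0" using assms(1) by simp
  show "is_code king_grid (code_lift n d C)"
    using assms(3) is_code_code_lift unfolding self_identifying_code_def by metis
  fix u v :: "int \<times> int"
  assume "u \<noteq> v"
  show "Iset king_grid (code_lift n d C) u - Iset king_grid (code_lift n d C) v \<noteq> {}"
  proof (cases "grid_proj n d u = grid_proj n d v")
    case True
    \<comment> \<open>Nonemptiness of the I-set is obtained by comparing the projected vertex with
      some other vertex \<open>w\<close>, which exists because \<open>n > 1\<close>.\<close>
    have "\<exists>w \<in> {0..<int n}. grid_proj n d u \<noteq> w"
      using assms(1) by (intro bexI[of _ "if grid_proj n d u = 0 then 1 else 0"]) auto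
    then have "Iset ?G C (grid_proj n d u) \<noteq> {}"
      using assms(3) grid_proj_in_verts[OF n, of d u]
      unfolding self_identifying_code_def verts_circulant_graph by blast
    then have "Iset king_grid (code_lift n d C) u \<noteq> {}"
      using grid_proj_image_Iset[OF n assms(2), of C u] by auto
    then show ?thesis
      using Iset_code_lift_not_subset[OF \<open>u \<noteq> v\<close> True, of C] by auto
  next
    case False
    then have "\<not> Iset ?G C (grid_proj n d u) \<subseteq> Iset ?G C (grid_proj n d v)"
      using assms(3) grid_proj_in_verts[OF n]
      unfolding self_identifying_code_def verts_circulant_graph Diff_eq_empty_iff by metis
    \<comment> \<open>Taking images preserves inclusion, so an inclusion of the grid I-sets would
      project to the one just excluded.\<close>
    then show ?thesis
      unfolding grid_proj_image_Iset[OF n assms(2), symmetric] by blast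
  qed
qed

section \<open>Counting residues in intervals of integers\<close>

lemma card_mod_in_period:
  fixes a :: int
  assumes "n > 0" "C \<subseteq> {0..<int n}"
  shows "card {x \<in> {a..<a + int n}. x mod int n \<in> C} = card C"
proof (rule bij_betw_same_card)
  show "bij_betw (\<lambda>x. x mod int n) {x \<in> {a..<a + int n}. x mod int n \<in> C} C"
  \<comment> \<open>The inverse sends a residue \<open>c\<close> to its unique representative in the
    window of length \<open>n\<close> starting at \<open>a\<close>.\<close>
  proof (rule bij_betw_byWitness[where f' = "\<lambda>c. a + (c - a) mod int n"])
    show "\<forall>x\<in>{x \<in> {a..<a + int n}. x mod int n \<in> C}. a + (x mod int n - a) mod int n = x"
      by (auto simp: mod_simps)
    show "\<forall>c\<in>C. (a + (c - a) mod int n) mod int n = c"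
      using assms(2) by (auto simp: mod_simps)
    show "(\<lambda>c. a + (c - a) mod int n) ` C \<subseteq> {x \<in> {a..<a + int n}. x mod int n \<in> C}"
      using assms by (auto simp: mod_simps subset_iff)
  qed auto
qed

lemma finite_int_interval_Collect [simp]: "finite {x :: int. a \<le> x \<and> x < b \<and> P x}"
  by (rule finite_subset[of _ "{a..<b}"]) auto

lemma card_mod_in_periods:
  fixes a :: int
  assumes "n > 0" "C \<subseteq> {0..<int n}"
  shows "card {x \<in> {a..<a + int (q * n)}. x mod int n \<in> C} = q * card C"
proof (induction q)
  case (Suc q)
  let ?b = "a + int (q * n)"
  have "{x \<in> {a..<a + int (Suc q * n)}. x mod int n \<in> C} =
      {x \<in> {a..<?b}. x mod int n \<in> C} \<union> {x \<in> {?b..<?b + int n}. x mod int n \<in> C}"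
    using ivl_disj_un_two(3)[of a ?b "?b + int n"] by (auto simp: algebra_simps)
  then show ?case
    using Suc card_mod_in_period[OF assms, of ?b] by (simp add: card_Un_disjoint disjoint_iff)
qed simp

text \<open>With \<open>q = L div n\<close>, the interval lies between \<open>q\<close> and
  \<open>q + 1\<close> full periods. Both the count and \<open>card C * L / n\<close> therefore lie
  between \<open>q * card C\<close> and \<open>(q + 1) * card C\<close>. The start \<open>a\<close>
  is arbitrary and the error does not depend on it or on \<open>L\<close>.\<close>

lemma card_mod_in_interval_bounds:
  fixes a :: int
  assumes "n > 0" "C \<subseteq> {0..<int n}"
  shows "\<bar>real (card {x \<in> {a..<a + int L}. x mod int n \<in> C}) - real (card C) * real L / real n\<bar>
    \<le> real (card C)"
proof -
  define q where "q = L div n"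
  let ?S = "\<lambda>L. {x \<in> {a..<a + int L}. x mod int n \<in> C}"
  have q: "q * n \<le> L" "L \<le> Suc q * n"
    using assms(1) dividend_less_div_times[of n L] by (auto simp: q_def)
  have "card (?S (q * n)) \<le> card (?S L)" "card (?S L) \<le> card (?S (Suc q * n))"
    using q by (auto intro!: card_mono simp del: mult_Suc simp flip: of_nat_mult)
  then have "q * card C \<le> card (?S L)" "card (?S L) \<le> Suc q * card C"
    unfolding card_mod_in_periods[OF assms] .
  then have S: "real q * real (card C) \<le> real (card (?S L))"
    "real (card (?S L)) \<le> (real q + 1) * real (card C)"
    by (metis of_nat_le_iff of_nat_mult of_nat_Suc add.commute)+
  have "real q \<le> real L / real n" "real L / real n \<le> real q + 1"
    using assms(1) q[THEN of_nat_mono[where ?'a = real]] by (auto simp: field_simps)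
  from this[THEN mult_right_mono, of "real (card C)"]
  have "real q * real (card C) \<le> real (card C) * real L / real n"
    "real (card C) * real L / real n \<le> (real q + 1) * real (card C)"
    by (simp_all add: mult.commute)
  with S show ?thesis
    unfolding abs_le_iff distrib_right by linarith
qed

section \<open>Density of the lifted code\<close>

lemma Qbox_eq: "Qbox m = {- int m..int m} \<times> {- int m..int m}"
  by (auto simp: Qbox_def)

lemma card_Qbox: "card (Qbox m) = (2 * m + 1)\<^sup>2"
  by (simp add: Qbox_eq card_cartesian_product power2_eq_square nat_add_distrib nat_mult_distrib)

text \<open>The shear \<open>(x, y) \<mapsto> (y, x + d * y)\<close> turns row \<open>y\<close> of
  the box into a window of \<open>2 * m + 1\<close> consecutive integers, on which membership in the
  lift depends only on the residue.\<close>

lemma card_code_lift_Qbox: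
  "card (code_lift n d C \<inter> Qbox m) = (\<Sum>y \<in> {- int m..int m}.
     card {x \<in> {int d * y - int m..<int d * y - int m + int (2 * m + 1)}. x mod int n \<in> C})"
proof -
  let ?R = "\<lambda>y. {x \<in> {int d * y - int m..<int d * y - int m + int (2 * m + 1)}. x mod int n \<in> C}"
  let ?f = "\<lambda>(x, y). (y, x + int d * y)"
  have "bij_betw ?f (code_lift n d C \<inter> Qbox m) (Sigma {- int m..int m} ?R)"
    by (rule bij_betw_byWitness[where f' = "\<lambda>(y, x). (x - int d * y, y)"])
      (auto simp: code_lift_def grid_proj_def Qbox_eq)
  then have "card (code_lift n d C \<inter> Qbox m) = card (Sigma {- int m..int m} ?R)"
    by (rule bij_betw_same_card)
  then show ?thesis by (subst (asm) card_SigmaI) auto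
qed

text \<open>Each of the \<open>2 * m + 1\<close> rows deviates from its expected count by at most
  \<open>card C\<close>. After division by \<open>(2 * m + 1)\<^sup>2\<close> the total error is at
  most \<open>card C / (2 * m + 1)\<close>, so the ratios converge and the limsup is their
  limit.\<close>

lemma grid_density_code_lift:
  assumes "n > 0" "C \<subseteq> {0..<int n}"
  shows "grid_density (code_lift n d C) = ereal (real (card C) / real n)"
proof -
  let ?r = "\<lambda>m. real (card (code_lift n d C \<inter> Qbox m)) / real (card (Qbox m))"
  let ?k = "real (card C)"
  have bound: "\<bar>?r m - ?k / real n\<bar> \<le> ?k / real (2 * m + 1)" for m
  proof -
    let ?R = "\<lambda>y. {x \<in> {int d * y - int m..<int d * y - int m + int (2 * m + 1)}. x mod int n \<in> C}"
    define N where "N = real (2 * m + 1)"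
    have N: "N > 0" by (simp add: N_def)
    have cardI: "real (card {- int m..int m}) = N"
      by (simp add: N_def nat_add_distrib nat_mult_distrib)
    \<comment> \<open>\<open>?k * N / n\<close> is the expected count in one row of length
      \<open>N\<close>, and there are \<open>N\<close> rows.\<close>
    have diff: "real (card (code_lift n d C \<inter> Qbox m)) - N * (?k * N / real n) =
        (\<Sum>y \<in> {- int m..int m}. real (card (?R y)) - ?k * N / real n)"
      unfolding card_code_lift_Qbox sum_subtractf sum_constant cardI by simp
    have "\<bar>real (card (code_lift n d C \<inter> Qbox m)) - N * (?k * N / real n)\<bar> \<le>
        (\<Sum>y \<in> {- int m..int m}. \<bar>real (card (?R y)) - ?k * N / real n\<bar>)"
      unfolding diff by (rule sum_abs)
    also have "\<dots> \<le> (\<Sum>y \<in> {- int m..int m}. ?k)"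
      unfolding N_def by (rule sum_mono, rule card_mod_in_interval_bounds[OF assms])
    also have "\<dots> = N * ?k"
      unfolding sum_constant cardI ..
    finally have "\<bar>real (card (code_lift n d C \<inter> Qbox m)) - N * (?k * N / real n)\<bar> / N\<^sup>2
        \<le> N * ?k / N\<^sup>2"
      by (rule divide_right_mono) simp
    moreover have "real (card (Qbox m)) = N\<^sup>2"
      unfolding card_Qbox N_def of_nat_power ..
    moreover have "real (card (code_lift n d C \<inter> Qbox m)) / N\<^sup>2 - ?k / real n =
        (real (card (code_lift n d C \<inter> Qbox m)) - N * (?k * N / real n)) / N\<^sup>2"
      using N by (simp add: diff_divide_distrib power2_eq_square)
    ultimately show ?thesis
      using N unfolding N_def[symmetric] by (simp add: abs_divide power2_eq_square)
  qed
  have lim: "(\<lambda>m. ?k / real (2 * m + 1)) \<longlonglongrightarrow> 0"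
    by (rule tendsto_divide_0[OF tendsto_const], rule filterlim_at_top_imp_at_infinity,
        rule filterlim_compose[OF filterlim_real_sequentially],
        rule filterlim_subseq) (simp add: strict_mono_def)
  have "?r \<longlonglongrightarrow> ?k / real n"
  proof (rule metric_tendsto_imp_tendsto[OF lim], rule always_eventually, rule allI)
    fix m
    have "dist (?r m) (?k / real n) \<le> ?k / real (2 * m + 1)"
      using bound unfolding dist_real_def .
    moreover have "dist (?k / real (2 * m + 1)) 0 = ?k / real (2 * m + 1)"
      by (simp add: dist_real_def)
    ultimately show "dist (?r m) (?k / real n) \<le> dist (?k / real (2 * m + 1)) 0"
      by (simp only:)
  qed
  then show ?thesis
    unfolding grid_density_def by (intro lim_imp_Limsup trivial_limit_sequentially tendsto_ereal)
qed

theorem theorem3: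
  fixes n d k :: nat
  assumes "n > 0" and "k > 0" and "d \<ge> 3" and "real (d + 1) \<le> real n / 2"
  shows "(\<forall>C. identifying_code (circulant_graph n {1, d - 1, d, d + 1}) C \<and> card C = k \<longrightarrow>
            (\<exists>C'. identifying_code king_grid C' \<and>
                  grid_density C' = ereal (real k / real n)))
       \<and> (\<forall>C. locating_dominating_code (circulant_graph n {1, d - 1, d, d + 1}) C \<and> card C = k \<longrightarrow>
            (\<exists>C'. locating_dominating_code king_grid C' \<and>
                  grid_density C' = ereal (real k / real n)))
       \<and> (\<forall>C. self_identifying_code (circulant_graph n {1, d - 1, d, d + 1}) C \<and> card C = k \<longrightarrow>
            (\<exists>C'. self_identifying_code king_grid C' \<and>
                  grid_density C' = ereal (real k / real n)))"
proof -
  \<comment> \<open>The bounds \<open>d \<ge> 3\<close> and \<open>d + 1 \<le> n / 2\<close> give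
    \<open>n \<ge> 8\<close>; the self-identifying case uses \<open>n > 1\<close>.\<close>
  have d: "d > 0" and n: "n > 1"
    using assms(3,4) by linarith+
  have density: "grid_density (code_lift n d C) = ereal (real (card C) / real n)"
    if "is_code (circulant_graph n D) C" for C D
    using that by (intro grid_density_code_lift[OF assms(1)]) (simp add: is_code_def)
  show ?thesis
  \<comment> \<open>In all three cases the witness is \<open>code_lift n d C\<close>, whose density
    depends only on \<open>n\<close> and \<open>card C\<close>.\<close>
  proof (intro conjI allI impI; elim conjE)
    fix C
    assume "identifying_code (circulant_graph n {1, d - 1, d, d + 1}) C" "card C = k"
    then show "\<exists>C'. identifying_code king_grid C' \<and> grid_density C' = ereal (real k / real n)"
      using identifying_code_code_lift[OF assms(1) d] density
      unfolding identifying_code_def dominating_code_def by blast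
  next
    fix C
    assume "locating_dominating_code (circulant_graph n {1, d - 1, d, d + 1}) C" "card C = k"
    then show "\<exists>C'. locating_dominating_code king_grid C' \<and>
        grid_density C' = ereal (real k / real n)"
      using locating_dominating_code_code_lift[OF assms(1) d] density
      unfolding locating_dominating_code_def dominating_code_def by blast
  next
    fix C
    assume "self_identifying_code (circulant_graph n {1, d - 1, d, d + 1}) C" "card C = k"
    then show "\<exists>C'. self_identifying_code king_grid C' \<and>
        grid_density C' = ereal (real k / real n)"
      using self_identifying_code_code_lift[OF n d] density
      unfolding self_identifying_code_def by blast
  qed
qed

end
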